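(* If $n=2^k$, where $k\ge 1$ is an integer, then $\rho_e^o(Q_n)=2^{n-1}$.
   Context: All graphs are finite and simple. A set $B\subseteq E(G)$ is an edge open packing set (EOP set) of $G$ if for any two distinct edges $e_1,e_2\in B$ there is no edge $e\in E(G)\setminus\{e_1,e_2\}$ joining an endvertex of $e_1$ to an endvertex of $e_2$ (that is, no edge $e$ such that $e_1,e,e_2$ form a path with middle edge $e$ or a triangle). Edges of $B$ may share an endvertex. The maximum cardinality of an EOP set is the EOP number $\rho_e^o(G)$. $Q_n$ is the $n$-dimensional hypercube: $Q_1=K_2$ and $Q_n=Q_{n-1}\,\square\,K_2$ for $n\ge 2$, where in the Cartesian product $G\,\square\,H$ (on vertex set $V(G)\times V(H)$) two vertices are adjacent if they are adjacent in one coordinate and equal in the other. *)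

theory Defs
  imports Main
begin

record 'a graph =
  verts :: "'a set"
  edges :: "'a set set"

definition simple_graph :: "'a graph \<Rightarrow> bool" where
  "simple_graph G \<longleftrightarrow> finite (verts G) \<and> (\<forall>e\<in>edges G. e \<subseteq> verts G \<and> card e = 2)"

definition adjacent :: "'a graph \<Rightarrow> 'a \<Rightarrow> 'a \<Rightarrow> bool" where
  "adjacent G u v \<longleftrightarrow> {u, v} \<in> edges G"

definition cart_prod :: "'a graph \<Rightarrow> 'b graph \<Rightarrow> ('a \<times> 'b) graph" where
  "cart_prod G H =
     \<lparr>verts = verts G \<times> verts H,
      edges = {{(u, x), (v, y)} | u x v y.
        u \<in> verts G \<and> v \<in> verts G \<and> x \<in> verts H \<and> y \<in> verts H \<and>
        (adjacent G u v \<and> x = y \<or> u = v \<and> adjacent H x y)}\<rparr>"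

definition K2 :: "bool graph" where
  "K2 = \<lparr>verts = {False, True}, edges = {{False, True}}\<rparr>"

definition relabel :: "('a \<Rightarrow> 'b) \<Rightarrow> 'a graph \<Rightarrow> 'b graph" where
  "relabel f G = \<lparr>verts = f ` verts G, edges = (\<lambda>e. f ` e) ` edges G\<rparr>"

text \<open>
  The iterated product lives on a different type for every dimension. To have all
  hypercubes on one type, its vertices are renamed injectively to lists of bits.
  The value at 0 (one vertex, no edge) is only a convention.
\<close>

fun hypercube :: "nat \<Rightarrow> bool list graph" where
  "hypercube 0 = \<lparr>verts = {[]}, edges = {}\<rparr>"
| "hypercube (Suc 0) = relabel (\<lambda>b. [b]) K2"
| "hypercube (Suc (Suc n)) =
     relabel (\<lambda>(xs, b). b # xs) (cart_prod (hypercube (Suc n)) K2)"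

text \<open>
  The witness below ranges over the edges other than \<open>e1\<close> and \<open>e2\<close>, so for edges
  sharing an endvertex only a triangle is excluded.
\<close>

definition eop_set :: "'a graph \<Rightarrow> 'a set set \<Rightarrow> bool" where
  "eop_set G B \<longleftrightarrow> B \<subseteq> edges G \<and>
     (\<forall>e1\<in>B. \<forall>e2\<in>B. e1 \<noteq> e2 \<longrightarrow>
        \<not> (\<exists>e \<in> edges G - {e1, e2}. \<exists>u\<in>e1. \<exists>v\<in>e2. e = {u, v}))"

definition eop_number :: "'a graph \<Rightarrow> nat" where
  "eop_number G = Max {card B | B. eop_set G B}"

lemma finite_edges: "simple_graph G \<Longrightarrow> finite (edges G)"
  unfolding simple_graph_def by (rule finite_subset[of _ "Pow (verts G)"]) auto

lemma finite_eop_cards: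
  assumes "simple_graph G"
  shows "finite {card B | B. eop_set G B}"
proof -
  have "{card B | B. eop_set G B} \<subseteq> card ` Pow (edges G)"
    by (auto simp: eop_set_def)
  then show ?thesis
    using finite_edges[OF assms] by (meson finite_Pow_iff finite_imageI finite_subset)
qed

lemma eop_set_empty: "eop_set G {}"
  by (simp add: eop_set_def)

lemma simple_graph_K2: "simple_graph K2"
  by (simp add: simple_graph_def K2_def)

lemma simple_graph_relabel:
  assumes "simple_graph G" "inj f"
  shows "simple_graph (relabel f G)"
  using assms unfolding simple_graph_def relabel_def
  by (auto simp: card_image inj_on_subset)

lemma simple_graph_cart_prod:
  assumes "simple_graph G" "simple_graph H"
  shows "simple_graph (cart_prod G H)"
proof -
  have "u \<noteq> v" if "adjacent G u v" for u v
    using that assms(1) by (force simp: simple_graph_def adjacent_def)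
  moreover have "u \<noteq> v" if "adjacent H u v" for u v
    using that assms(2) by (force simp: simple_graph_def adjacent_def)
  ultimately show ?thesis
    using assms unfolding simple_graph_def cart_prod_def
    by (auto simp: card_insert_if)
qed

lemma simple_graph_hypercube: "simple_graph (hypercube n)"
proof (induction n rule: hypercube.induct)
  case 1
  show ?case by (simp add: simple_graph_def)
next
  case 2
  show ?case by (simp add: simple_graph_relabel simple_graph_K2 inj_def)
next
  case (3 n)
  then show ?case
    by (auto intro!: simple_graph_relabel simple_graph_cart_prod simple_graph_K2 simp: inj_def)
qed

lemma verts_hypercube: "verts (hypercube n) = {xs. length xs = n}"
  by (induction n rule: hypercube.induct)
    (auto simp: relabel_def K2_def cart_prod_def length_Suc_conv image_iff)

end

theory Submission
  imports Defs
begin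

text \<open>
  Upper bound: every edge of an EOP set has an endvertex that lies on no other edge of the set,
  and such endvertices form an independent set; a perfect matching of \<open>Q\<^sub>n\<close> shows
  that an independent set has at most \<open>2\<^sup>n\<^sup>-\<^sup>1\<close> elements.
  Lower bound: if \<open>n = 2\<^sup>k\<close>, every odd vertex of \<open>Q\<^sub>n\<close> has exactly one
  neighbour in the extended Hamming code, and the edges from the odd vertices to the code are an
  EOP set.
\<close>

section \<open>Hypercube edges as single bit flips\<close>

definition flip :: "nat \<Rightarrow> bool list \<Rightarrow> bool list" where
  "flip i xs = xs[i := \<not> xs ! i]"

lemma length_flip [simp]: "length (flip i xs) = length xs"
  by (simp add: flip_def)

lemma flip_flip [simp]: "flip i (flip i xs) = xs"
  by (cases "i < length xs") (simp_all add: flip_def list_update_beyond)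

lemma flip_Cons_0 [simp]: "flip 0 (b # xs) = (\<not> b) # xs"
  by (simp add: flip_def)

lemma flip_Cons_Suc [simp]: "flip (Suc i) (b # xs) = b # flip i xs"
  by (simp add: flip_def)

text \<open>Closed form of the recursively built edge set of \<open>hypercube n\<close>; the two
  agree by \<open>edges_hypercube\<close>.\<close>

definition cube_edges :: "nat \<Rightarrow> bool list set set" where
  "cube_edges n = {{xs, flip i xs} | xs i. length xs = n \<and> i < n}"

lemma cube_edgesI: "length xs = n \<Longrightarrow> i < n \<Longrightarrow> {xs, flip i xs} \<in> cube_edges n"
  by (auto simp: cube_edges_def)

lemma cube_edges_iff:
  "{u, v} \<in> cube_edges n \<longleftrightarrow> length u = n \<and> (\<exists>i<n. v = flip i u)"
proof
  assume "{u, v} \<in> cube_edges n"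
  then obtain xs i where "length xs = n" "i < n" "{u, v} = {xs, flip i xs}"
    by (auto simp: cube_edges_def)
  then show "length u = n \<and> (\<exists>i<n. v = flip i u)"
    by (auto simp: doubleton_eq_iff)
qed (auto intro: cube_edgesI)

text \<open>The relabelling puts the \<open>K2\<close> coordinate in front, so flipping index
  \<open>0\<close> moves along \<open>K2\<close> and flipping \<open>Suc j\<close> flips index
  \<open>j\<close> in the smaller cube.\<close>

lemma edges_hypercube: "edges (hypercube n) = cube_edges n"
proof (induction n rule: hypercube.induct)
  case 1
  show ?case by (simp add: cube_edges_def)
next
  case 2
  have "cube_edges (Suc 0) = (\<lambda>b. {[b], [\<not> b]}) ` UNIV"
    by (fastforce simp: cube_edges_def length_Suc_conv image_iff)
  then have "cube_edges (Suc 0) = {{[False], [True]}}"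
    by (simp add: UNIV_bool insert_commute)
  then show ?case by (simp add: relabel_def K2_def)
next
  case (3 m)
  define n where "n = Suc m"
  have adj: "adjacent (hypercube n) u v \<longleftrightarrow> length u = n \<and> (\<exists>i<n. v = flip i u)" for u v
    using 3 by (simp add: adjacent_def n_def cube_edges_iff)
  have K2: "adjacent K2 x y \<longleftrightarrow> y = (\<not> x)" for x y
    by (auto simp: adjacent_def K2_def doubleton_eq_iff)
  have vK2: "verts K2 = UNIV"
    by (auto simp: K2_def)
  have prod: "edges (cart_prod (hypercube n) K2) = {{(u, x), (v, y)} | u x v y. length u = n \<and>
          (x = y \<and> (\<exists>i<n. v = flip i u) \<or> u = v \<and> y = (\<not> x))}"
    unfolding cart_prod_def adj K2 verts_hypercube vK2 graph.simps
    by (intro Collect_cong ex_cong1) auto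
  define f :: "bool list \<times> bool \<Rightarrow> bool list" where "f = (\<lambda>(xs, b). b # xs)"
  have f: "f (u, x) = x # u" for u x
    by (simp add: f_def)
  have Q: "edges (hypercube (Suc n)) = (`) f ` edges (cart_prod (hypercube n) K2)"
    by (simp add: n_def relabel_def f_def)
  have "edges (hypercube (Suc n)) = cube_edges (Suc n)"
  proof (intro equalityI subsetI)
    fix e assume "e \<in> edges (hypercube (Suc n))"
    then obtain u x v y where e: "e = f ` {(u, x), (v, y)}" and l: "length u = n"
      and *: "x = y \<and> (\<exists>i<n. v = flip i u) \<or> u = v \<and> y = (\<not> x)"
      unfolding Q prod by blast
    from * have "\<exists>i<Suc n. y # v = flip i (x # u)"
      by (auto simp: Ex_less_Suc2)
    with l show "e \<in> cube_edges (Suc n)"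
      by (simp add: e f cube_edges_iff)
  next
    fix e assume "e \<in> cube_edges (Suc n)"
    then obtain xs i where e: "e = {xs, flip i xs}" and l: "length xs = Suc n" and i: "i < Suc n"
      by (auto simp: cube_edges_def)
    from l obtain x u where xs: "xs = x # u" "length u = n"
      by (auto simp: length_Suc_conv)
    show "e \<in> edges (hypercube (Suc n))"
    proof (cases i)
      case 0
      then have "e = f ` {(u, x), (u, \<not> x)}" by (simp add: e xs f)
      moreover have "{(u, x), (u, \<not> x)} \<in> edges (cart_prod (hypercube n) K2)"
        unfolding prod using xs by blast
      ultimately show ?thesis unfolding Q by blast
    next
      case (Suc j)
      then have "e = f ` {(u, x), (flip j u, x)}" by (simp add: e xs f)
      moreover have "{(u, x), (flip j u, x)} \<in> edges (cart_prod (hypercube n) K2)"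
        unfolding prod using xs i Suc by blast
      ultimately show ?thesis unfolding Q by blast
    qed
  qed
  then show ?case by (simp only: n_def)
qed

section \<open>Private endvertices and the upper bound\<close>

lemma eop_setD:
  assumes "eop_set G B" "e1 \<in> B" "e2 \<in> B" "e1 \<noteq> e2" "{u, v} \<in> edges G" "u \<in> e1" "v \<in> e2"
  shows "{u, v} = e1 \<or> {u, v} = e2"
  using assms unfolding eop_set_def by blast

text \<open>Otherwise \<open>e\<close> would meet other edges of \<open>B\<close> at both ends and
  hence join two of them.\<close>

lemma eop_set_private_endvertex:
  assumes G: "simple_graph G" and B: "eop_set G B" and e: "e \<in> B"
  shows "\<exists>v\<in>e. \<forall>e'\<in>B. v \<in> e' \<longrightarrow> e' = e"
proof (rule ccontr)
  assume none: "\<not> ?thesis"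
  have card: "card e' = 2" if "e' \<in> B" for e'
    using that G B by (auto simp: simple_graph_def eop_set_def)
  obtain u v where uv: "e = {u, v}" "u \<noteq> v"
    using card[OF e] by (auto simp: card_2_iff)
  obtain e1 e2 where e12: "e1 \<in> B" "u \<in> e1" "e1 \<noteq> e" "e2 \<in> B" "v \<in> e2" "e2 \<noteq> e"
    using none uv by auto
  \<comment> \<open>In a simple graph, an edge through both \<open>u\<close> and \<open>v\<close> is
    \<open>e\<close> itself.\<close>
  have "e1 \<noteq> e2"
  proof
    assume "e1 = e2"
    then have "{u, v} \<subseteq> e1" "card e1 = 2"
      using e12 card by auto
    then have "{u, v} = e1"
      using uv by (intro card_subset_eq) (auto intro: card_ge_0_finite)
    then show False using e12 uv by simp
  qed
  moreover have "{u, v} \<in> edges G"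
    using B e uv by (auto simp: eop_set_def)
  ultimately show False
    using eop_setD[OF B, of e1 e2 u v] e12 uv by blast
qed

text \<open>Choose one private endvertex per edge. An edge between two chosen vertices joins their
  edges, so it is one of these and contains the private endvertex of the other.\<close>

lemma eop_set_independent:
  assumes G: "simple_graph G" and B: "eop_set G B"
  obtains L where "L \<subseteq> verts G" "card L = card B"
    "\<And>u v. u \<in> L \<Longrightarrow> v \<in> L \<Longrightarrow> \<not> adjacent G u v"
proof -
  obtain l where l: "\<And>e. e \<in> B \<Longrightarrow> l e \<in> e"
    and priv: "\<And>e e'. e \<in> B \<Longrightarrow> e' \<in> B \<Longrightarrow> l e \<in> e' \<Longrightarrow> e' = e"
    using eop_set_private_endvertex[OF G B] by metis
  have sub: "e \<subseteq> verts G" if "e \<in> B" for e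
    using that G B by (auto simp: simple_graph_def eop_set_def)
  have inj: "inj_on l B"
    using l priv by (metis inj_onI)
  have indep: "\<not> adjacent G (l e) (l e')" if e: "e \<in> B" "e' \<in> B" for e e'
  proof
    assume adj: "adjacent G (l e) (l e')"
    then have "card {l e, l e'} = 2"
      using G by (auto simp: simple_graph_def adjacent_def)
    then have "e \<noteq> e'" by auto
    then have "{l e, l e'} = e \<or> {l e, l e'} = e'"
      using eop_setD[OF B, of e e' "l e" "l e'"] adj e l by (simp add: adjacent_def)
    then show False
      using priv[of e e'] priv[of e' e] e \<open>e \<noteq> e'\<close> by blast
  qed
  show ?thesis
  proof
    show "l ` B \<subseteq> verts G" using l sub by blast
    show "card (l ` B) = card B" using inj by (rule card_image)
  qed (use indep in auto)
qed

lemma card_bool_lists: "card {xs :: bool list. length xs = n} = 2 ^ n"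
  using card_lists_length_eq[of "UNIV :: bool set" n] by (simp add: card_UNIV_bool)

lemma finite_bool_lists: "finite {xs :: bool list. length xs = n}"
  using finite_lists_length_eq[of "UNIV :: bool set" n] by simp

lemma card_eop_set_hypercube_le:
  assumes "n > 0" and B: "eop_set (hypercube n) B"
  shows "card B \<le> 2 ^ (n - 1)"
proof -
  obtain L where L: "L \<subseteq> verts (hypercube n)" "card L = card B"
    and indep: "\<And>u v. u \<in> L \<Longrightarrow> v \<in> L \<Longrightarrow> \<not> adjacent (hypercube n) u v"
    using eop_set_independent[OF simple_graph_hypercube B] by metis
  have len: "length u = n" if "u \<in> L" for u
    using L that by (auto simp: verts_hypercube)
  have fin: "finite L"
    using L finite_bool_lists by (auto simp: verts_hypercube intro: finite_subset)
  \<comment> \<open>The matching pairs \<open>u\<close> with \<open>flip 0 u\<close>; these are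
    adjacent because \<open>n > 0\<close> puts index \<open>0\<close> in range.\<close>
  have disj: "L \<inter> flip 0 ` L = {}"
    using indep len \<open>n > 0\<close>
    by (fastforce simp: adjacent_def edges_hypercube cube_edges_iff)
  have "card (flip 0 ` L) = card L"
    by (intro card_image inj_onI) (metis flip_flip)
  then have "2 * card B = card (L \<union> flip 0 ` L)"
    using fin disj L by (simp add: card_Un_disjoint)
  also have "\<dots> \<le> card {xs :: bool list. length xs = n}"
    using len by (intro card_mono finite_bool_lists) auto
  also have "\<dots> = 2 * 2 ^ (n - 1)"
    using \<open>n > 0\<close> by (simp add: card_bool_lists power_eq_if)
  finally show ?thesis by simp
qed

section \<open>Extended Hamming code and the lower bound\<close>

definition parity :: "bool list \<Rightarrow> bool" where
  "parity xs \<longleftrightarrow> odd (count_list xs True)"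

lemma parity_Cons: "parity (b # xs) \<longleftrightarrow> b \<noteq> parity xs"
  by (simp add: parity_def)

lemma parity_flip: "i < length xs \<Longrightarrow> parity (flip i xs) \<longleftrightarrow> \<not> parity xs"
  by (induction xs arbitrary: i) (auto simp: parity_Cons less_Suc_eq_0_disj)

lemma card_odd_bool_lists: "card {xs. length xs = Suc n \<and> parity xs} = 2 ^ n"
proof -
  \<comment> \<open>The last \<open>n\<close> bits are free and determine the head.\<close>
  have "{xs. length xs = Suc n \<and> parity xs} = (\<lambda>xs. (\<not> parity xs) # xs) ` {xs. length xs = n}"
    by (auto simp: length_Suc_conv parity_Cons image_iff)
  then show ?thesis
    by (simp add: card_image inj_on_def card_bool_lists)
qed

text \<open>
  \<open>syndrome m xs\<close> is the bitwise sum of the numbers \<open>m + i\<close> over the positions \<open>i\<close>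
  with \<open>xs ! i\<close>. The extended Hamming code consists of the words of even parity and zero
  syndrome; among the neighbours of an odd word \<open>xs\<close>, only \<open>flip (syndrome 0 xs) xs\<close>
  belongs to it.
\<close>

fun syndrome :: "nat \<Rightarrow> bool list \<Rightarrow> nat" where
  "syndrome m [] = 0"
| "syndrome m (b # xs) =
     semiring_bit_operations_class.xor (if b then m else 0) (syndrome (Suc m) xs)"

text \<open>Under xor, adding and removing the label \<open>m + i\<close> are the same
  operation.\<close>

lemma syndrome_flip:
  "i < length xs \<Longrightarrow>
    syndrome m (flip i xs) = semiring_bit_operations_class.xor (m + i) (syndrome m xs)"
proof (induction xs arbitrary: i m)
  case (Cons b xs)
  show ?case
  proof (cases i)
    case 0
    then show ?thesis by (simp flip: xor.assoc)
  next
    case (Suc j)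
    then show ?thesis using Cons by (simp add: xor.left_commute)
  qed
qed simp

text \<open>All labels are \<open>k\<close>-bit numbers, which are closed under xor. For
  \<open>m = 0\<close> and length \<open>2 ^ k\<close> the syndrome is thus a valid position; here
  the power of two enters.\<close>

lemma syndrome_less: "m + length xs \<le> 2 ^ k \<Longrightarrow> syndrome m xs < 2 ^ k"
proof (induction xs arbitrary: m)
  case (Cons b xs)
  then have "syndrome (Suc m) xs < 2 ^ k" "(if b then m else 0) < 2 ^ k"
    by simp_all
  then show ?case
    by (metis syndrome.simps(2) take_bit_nat_eq_self_iff take_bit_xor)
qed simp

lemma xor_eq_0_nat_iff: "semiring_bit_operations_class.xor a b = 0 \<longleftrightarrow> a = b" for a b :: nat
  by (metis xor.assoc xor.left_neutral xor.right_neutral xor_self_eq)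

lemma syndrome_flip_eq_0_iff:
  "i < length xs \<Longrightarrow> syndrome 0 (flip i xs) = 0 \<longleftrightarrow> i = syndrome 0 xs"
  by (simp add: syndrome_flip xor_eq_0_nat_iff)

lemma ex_eop_set_hypercube:
  assumes n: "n = 2 ^ k"
  shows "\<exists>B. eop_set (hypercube n) B \<and> card B = 2 ^ (n - 1)"
proof -
  \<comment> \<open>\<open>c\<close> sends an odd word to its code neighbour, so \<open>B\<close> is
    a union of stars centred at codewords with odd words as leaves.\<close>
  define c where "c = (\<lambda>xs. flip (syndrome 0 xs) xs)"
  define D where "D = {xs. length xs = n \<and> parity xs}"
  define B where "B = (\<lambda>xs. {xs, c xs}) ` D"
  have syn: "syndrome 0 xs < n" if "xs \<in> D" for xs
    using that syndrome_less[of 0 xs k] by (simp add: D_def n)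
  have even_c: "\<not> parity (c xs)" if "xs \<in> D" for xs
    using that syn[OF that] by (simp add: D_def c_def parity_flip)
  have syn_c: "syndrome 0 (c xs) = 0" if "xs \<in> D" for xs
    using that syn[OF that] by (simp add: D_def c_def syndrome_flip_eq_0_iff)
  have odd: "parity xs" if "xs \<in> D" for xs
    using that by (simp add: D_def)
  \<comment> \<open>The codeword \<open>c ys\<close> is a neighbour of \<open>xs\<close>, and
    \<open>xs\<close> has only one code neighbour, namely \<open>c xs\<close>.\<close>
  have key: "c ys = c xs" if D: "xs \<in> D" "ys \<in> D" and e: "{xs, c ys} \<in> cube_edges n" for xs ys
  proof -
    obtain i where i: "i < n" "c ys = flip i xs"
      using e by (auto simp: cube_edges_iff)
    then have "i = syndrome 0 xs"
      using syn_c[of ys] syndrome_flip_eq_0_iff[of i xs] D by (simp add: D_def)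
    with i show ?thesis by (simp add: c_def)
  qed
  have same_parity: "{u, v} \<notin> cube_edges n" if "parity u = parity v" for u v
    using that by (auto simp: cube_edges_iff parity_flip)
  have "eop_set (hypercube n) B"
    unfolding eop_set_def edges_hypercube
  proof (intro conjI ballI impI notI)
    show "B \<subseteq> cube_edges n"
      using syn by (auto simp: B_def c_def D_def intro!: cube_edgesI)
  next
    fix e1 e2
    assume "e1 \<in> B" "e2 \<in> B"
    then obtain xs ys where D: "xs \<in> D" "ys \<in> D" and e: "e1 = {xs, c xs}" "e2 = {ys, c ys}"
      by (auto simp: B_def)
    assume "\<exists>e\<in>cube_edges n - {e1, e2}. \<exists>u\<in>e1. \<exists>v\<in>e2. e = {u, v}"
    then obtain u v where uv: "{u, v} \<in> cube_edges n" "{u, v} \<notin> {e1, e2}" "u \<in> e1" "v \<in> e2"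
      by blast
    \<comment> \<open>Edges change parity, so a joining edge runs from the odd end of one edge to
      the code end of the other. By \<open>key\<close> both code ends coincide, which makes it
      \<open>e1\<close> or \<open>e2\<close>.\<close>
    have "parity u \<noteq> parity v"
      using uv same_parity by blast
    then consider "u = xs" "v = c ys" | "u = c xs" "v = ys"
      using uv D e odd even_c by auto
    then show False
    proof cases
      case 1
      with key[of xs ys] D uv e show False by simp
    next
      case 2
      with key[of ys xs] D uv e show False by (simp add: insert_commute)
    qed
  qed
  \<comment> \<open>\<open>xs\<close> is the only odd word in \<open>{xs, c xs}\<close>.\<close>
  moreover have "inj_on (\<lambda>xs. {xs, c xs}) D"
    by (rule inj_onI) (metis doubleton_eq_iff even_c odd)
  then have "card B = 2 ^ (n - 1)"
    using card_odd_bool_lists[of "n - 1"] by (simp add: B_def D_def card_image n)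
  ultimately show ?thesis by blast
qed

theorem theorem5p10:
  fixes n k :: nat
  assumes "k \<ge> 1" and "n = 2 ^ k"
  shows "eop_number (hypercube n) = 2 ^ (n - 1)"
  unfolding eop_number_def
proof (rule Max_eqI)
  show "finite {card B | B. eop_set (hypercube n) B}"
    by (rule finite_eop_cards[OF simple_graph_hypercube])
  show "m \<le> 2 ^ (n - 1)" if "m \<in> {card B | B. eop_set (hypercube n) B}" for m
    using that card_eop_set_hypercube_le[of n] assms by auto
  show "2 ^ (n - 1) \<in> {card B | B. eop_set (hypercube n) B}"
    using ex_eop_set_hypercube[OF assms(2)] by force
qed

end
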